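(* Let $n\ge 0$ and $d\ge 0$ be integers and let $G=(V,E)$ be a non-empty induced subgraph of the hypercube $Q_n$ with minimum degree $\delta(G)=d$. Then either $|V|=2^d$ or $|V|\ge \frac{3}{2}\cdot 2^d$. Moreover, $|V|=2^d$ holds if and only if $G$ is a $d$-dimensional subcube of $Q_n$.
   Context: $Q_n$ is the graph with vertex set $\{0,1\}^n$ in which two vertices are adjacent iff they differ in exactly one coordinate; subgraphs are induced by their vertex sets. A $d$-dimensional subcube of $Q_n$ is the induced subgraph on the set of all vertices having prescribed bit values at $n-d$ fixed distinct positions. *)

theory Defs
  imports Complex_Main "Graph_Theory.Digraph_Component"
begin

text \<open>
  An undirected graph is represented as a symmetric digraph: every edge is a pair of opposite
  arcs, so the degree of a vertex is its out-degree. Vertices of the hypercube are bit strings of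
  length \<open>n\<close>, that is, lists of type \<^typ>\<open>bool list\<close>, with positions counted from \<open>0\<close>.
\<close>

definition hypercube :: "nat \<Rightarrow> (bool list, bool list \<times> bool list) pre_digraph" where
  "hypercube n = with_proj
     \<lparr> pverts = {v. length v = n},
       parcs = {(u, v). length u = n \<and> length v = n \<and> card {i. i < n \<and> u ! i \<noteq> v ! i} = 1} \<rparr>"

definition min_degree :: "('a, 'b) pre_digraph \<Rightarrow> nat" where
  "min_degree G = Min (out_degree G ` verts G)"

text \<open>
  \<open>I\<close> is the set of the \<open>n - d\<close> fixed positions and \<open>a\<close> gives the prescribed bits. The condition
  \<open>card I + d = n\<close> avoids truncated subtraction and forces \<open>d \<le> n\<close>.
\<close>

definition is_subcube :: "nat \<Rightarrow> nat \<Rightarrow> (bool list, bool list \<times> bool list) pre_digraph \<Rightarrow> bool" where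
  "is_subcube n d H \<longleftrightarrow>
     (\<exists>I a. I \<subseteq> {..<n} \<and> card I + d = n \<and>
        H = hypercube n \<restriction> {v \<in> verts (hypercube n). \<forall>i\<in>I. v ! i = a i})"

lemma graph_hypercube: "graph (hypercube n)"
proof -
  let ?Q = "\<lparr> pverts = {v :: bool list. length v = n},
    parcs = {(u, v). length u = n \<and> length v = n \<and> card {i. i < n \<and> u ! i \<noteq> v ! i} = 1} \<rparr>"
  have fin: "finite {v :: bool list. length v = n}"
    using finite_lists_length_eq[of "UNIV :: bool set" n] by simp
  have diff_commute: "{i. i < n \<and> u ! i \<noteq> v ! i} = {i. i < n \<and> v ! i \<noteq> u ! i}"
    for u v :: "bool list"
    by auto
  have "pair_graph ?Q"
  proof
    show "finite (pverts ?Q)" using fin by simp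
    show "finite (parcs ?Q)"
      by (rule finite_subset[OF _ finite_cartesian_product[OF fin fin]]) auto
    show "symmetric (with_proj ?Q)"
      unfolding symmetric_def with_proj_simps
    proof (rule symI)
      fix u v assume "(u, v) \<in> parcs ?Q"
      then show "(v, u) \<in> parcs ?Q"
        by (simp only: pair_pre_digraph.simps mem_Collect_eq case_prod_conv diff_commute[of v u])
    qed
    show "fst e \<in> pverts ?Q" if "e \<in> parcs ?Q" for e using that by (simp add: case_prod_beta)
    show "snd e \<in> pverts ?Q" if "e \<in> parcs ?Q" for e using that by (simp add: case_prod_beta)
    show "fst e \<noteq> snd e" if "e \<in> parcs ?Q" for e
    proof
      assume "fst e = snd e"
      moreover have "card {i. i < n \<and> fst e ! i \<noteq> snd e ! i} = 1"
        using that by (simp add: case_prod_beta)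
      ultimately show False by (simp only:) simp
    qed
  qed
  then show ?thesis
    unfolding hypercube_def by (rule pair_graph.pair_graphD_graph)
qed

end

theory Submission
  imports Defs
begin

text \<open>
  Induction on \<open>n\<close>, for minimum degree at least \<open>d\<close>: split \<open>V\<close> by the first bit into
  \<open>V\<^sub>0\<close> and \<open>V\<^sub>1\<close>. If both parts are non-empty, each has minimum degree at least \<open>d - 1\<close>, and the
  only case that is not immediate is that exactly one of them, say \<open>V\<^sub>0\<close>, is a
  \<open>(d - 1)\<close>-dimensional subcube. Then every vertex of \<open>V\<^sub>0\<close> needs its partner, so \<open>V\<^sub>0 \<subseteq> V\<^sub>1\<close>; and
  a vertex outside a subcube has at most one neighbour in it, so \<open>V\<^sub>1 - V\<^sub>0\<close> still has minimum
  degree at least \<open>d - 1\<close>. Hence \<open>|V| \<ge> 3 \<cdot> 2\<^bsup>d - 1\<^esup>\<close>.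
\<close>

section \<open>Degrees in the cube and the split by the first bit\<close>

definition flip :: "nat \<Rightarrow> bool list \<Rightarrow> bool list" where
  "flip i v = v[i := \<not> v ! i]"

text \<open>Neighbours are counted through the position to flip, which suits recursion on the first
  bit. Since \<open>v\<close> need not lie in \<open>S\<close>, the neighbours that an outside
  vertex has in a subcube can be counted too.\<close>

definition cube_degree :: "bool list set \<Rightarrow> bool list \<Rightarrow> nat" where
  "cube_degree S v = card {i. i < length v \<and> flip i v \<in> S}"

definition slice :: "bool \<Rightarrow> bool list set \<Rightarrow> bool list set" where
  "slice b S = {v. b # v \<in> S}"

lemma mem_slice [simp]: "v \<in> slice b S \<longleftrightarrow> b # v \<in> S"
  by (simp add: slice_def)

lemma slice_image_Cons: "slice b ((#) c ` S) = (if b = c then S else {})"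
  by (auto simp: slice_def)

lemma slice_Un: "slice b (S \<union> T) = slice b S \<union> slice b T"
  by (auto simp: slice_def)

lemma eq_Un_slices:
  assumes "S \<subseteq> {v. length v = Suc n}"
  shows "S = (#) True ` slice True S \<union> (#) False ` slice False S"
proof -
  have "v \<in> (#) True ` slice True S \<union> (#) False ` slice False S" if "v \<in> S" for v
  proof (cases v)
    case Nil
    with that assms show ?thesis by auto
  next
    case (Cons b w)
    with that show ?thesis by (cases b) auto
  qed
  then show ?thesis by auto
qed

lemma finite_length_eq: "finite {v :: bool list. length v = n}"
  using finite_lists_length_eq[of "UNIV :: bool set" n] by simp

lemma slice_length:
  "S \<subseteq> {v. length v = Suc n} \<Longrightarrow> slice b S \<subseteq> {v. length v = n}"
  by (auto simp: slice_def)

lemma card_eq_slices: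
  assumes "S \<subseteq> {v. length v = Suc n}"
  shows "card S = card (slice b S) + card (slice (\<not> b) S)"
proof -
  have fin: "finite (slice c S)" for c
    using slice_length[OF assms] finite_length_eq finite_subset by metis
  have "card S = card ((#) True ` slice True S \<union> (#) False ` slice False S)"
    using eq_Un_slices[OF assms] by simp
  also have "\<dots> = card ((#) True ` slice True S) + card ((#) False ` slice False S)"
    by (rule card_Un_disjoint) (auto simp: fin)
  also have "\<dots> = card (slice True S) + card (slice False S)"
    by (simp add: card_image)
  finally show ?thesis by (cases b) auto
qed

text \<open>Flipping position 0 crosses to the other half; flipping \<open>Suc i\<close> stays in
  the half of \<open>b\<close> and flips position \<open>i\<close> of \<open>w\<close>.\<close>

lemma cube_degree_Cons:
  "cube_degree S (b # w) = of_bool ((\<not> b) # w \<in> S) + cube_degree (slice b S) w"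
proof -
  let ?J = "{i. i < length w \<and> flip i w \<in> slice b S}"
  have "{i. i < length (b # w) \<and> flip i (b # w) \<in> S} =
      (if (\<not> b) # w \<in> S then {0} else {}) \<union> Suc ` ?J"
    (is "?L = ?R")
  proof (rule set_eqI)
    fix i show "i \<in> ?L \<longleftrightarrow> i \<in> ?R"
      by (cases i) (auto simp: flip_def)
  qed
  moreover have "card ?R = of_bool ((\<not> b) # w \<in> S) + card (Suc ` ?J)"
    by auto
  ultimately show ?thesis
    by (simp add: cube_degree_def card_image)
qed

lemma cube_degree_Un_le: "cube_degree (S \<union> T) v \<le> cube_degree S v + cube_degree T v"
proof -
  have "{i. i < length v \<and> flip i v \<in> S \<union> T} =
      {i. i < length v \<and> flip i v \<in> S} \<union> {i. i < length v \<and> flip i v \<in> T}"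
    by auto
  then show ?thesis
    by (simp add: cube_degree_def card_Un_le)
qed

lemma cube_degree_empty [simp]: "cube_degree {} v = 0"
  by (simp add: cube_degree_def)

section \<open>Subcubes built one coordinate at a time\<close>

inductive subcube :: "nat \<Rightarrow> nat \<Rightarrow> bool list set \<Rightarrow> bool" where
  point: "subcube 0 0 {[]}"
| fixed: "subcube n d S \<Longrightarrow> subcube (Suc n) d ((#) b ` S)"
| free: "subcube n d S \<Longrightarrow> subcube (Suc n) (Suc d) ((#) True ` S \<union> (#) False ` S)"

lemma subcube_length: "subcube n d S \<Longrightarrow> S \<subseteq> {v. length v = n}"
  by (induction rule: subcube.induct) auto

lemma card_subcube: "subcube n d S \<Longrightarrow> card S = 2 ^ d"
proof (induction rule: subcube.induct)
  case (free n d S)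
  then have "subcube (Suc n) (Suc d) ((#) True ` S \<union> (#) False ` S)"
    by (intro subcube.free)
  from card_eq_slices[OF subcube_length[OF this], of True] free.IH
  show ?case by (simp add: slice_Un slice_image_Cons)
qed (auto simp: card_image)

lemma cube_degree_subcube: "subcube n d S \<Longrightarrow> v \<in> S \<Longrightarrow> cube_degree S v = d"
proof (induction arbitrary: v rule: subcube.induct)
  case point
  then show ?case by (simp add: cube_degree_def)
next
  case (fixed n d S b)
  then obtain w where "v = b # w" "w \<in> S" by blast
  moreover have "(\<not> b) # w \<notin> (#) b ` S" by auto
  ultimately show ?case using fixed.IH[of w] by (simp add: cube_degree_Cons slice_image_Cons)
next
  case (free n d S)
  then obtain b w where "v = b # w" "w \<in> S" by blast
  with free.IH[of w] show ?case
    by (cases b) (simp_all add: cube_degree_Cons slice_Un slice_image_Cons)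
qed

text \<open>In case \<open>fixed\<close>, a vertex with the wrong first bit can reach the subcube
  only by flipping that bit; with the right first bit its tail is outside and the induction
  hypothesis applies. In case \<open>free\<close> the tail is outside both copies, so flipping the
  first bit never helps.\<close>

lemma cube_degree_outside_subcube:
  "subcube n d S \<Longrightarrow> length v = n \<Longrightarrow> v \<notin> S \<Longrightarrow> cube_degree S v \<le> 1"
proof (induction arbitrary: v rule: subcube.induct)
  case point
  then show ?case by simp
next
  case (fixed n d S b)
  then obtain c w where v: "v = c # w" "length w = n"
    by (cases v) auto
  with fixed show ?case
    by (auto simp: cube_degree_Cons slice_image_Cons)
next
  case (free n d S)
  then obtain c w where v: "v = c # w" "length w = n"
    by (cases v) auto
  with free.prems have "w \<notin> S" by (cases c) auto
  with v free.IH[of w] show ?case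
    by (cases c) (auto simp: cube_degree_Cons slice_Un slice_image_Cons)
qed

section \<open>The dichotomy for vertex sets\<close>

lemma min_degree_subcube_or_large:
  assumes "S \<subseteq> {v. length v = n}" "S \<noteq> {}" "\<And>v. v \<in> S \<Longrightarrow> d \<le> cube_degree S v"
  shows "subcube n d S \<or> 3 * 2 ^ d \<le> 2 * card S"
  using assms
proof (induction n arbitrary: S d)
  case 0
  then have S: "S = {[]}" by auto
  with 0(3)[of "[]"] have "d = 0" by (simp add: cube_degree_def)
  with S show ?case by (simp add: subcube.point)
next
  case (Suc n)
  note len = slice_length[OF Suc.prems(1)]
  note split = eq_Un_slices[OF Suc.prems(1)] and card = card_eq_slices[OF Suc.prems(1)]
  have deg: "d \<le> of_bool ((\<not> b) # w \<in> S) + cube_degree (slice b S) w" if "b # w \<in> S" for b w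
    using Suc.prems(3)[OF that] by (simp add: cube_degree_Cons)
  show ?case
  proof (cases "\<exists>b. slice b S = {}")
    \<comment> \<open>All of \<open>S\<close> lies in one half, so dropping the first bit loses no
      neighbour and the induction hypothesis applies with the same \<open>d\<close>.\<close>
    case True
    then obtain c where "slice c S = {}" by blast
    then obtain b where b: "slice (\<not> b) S = {}" using that[of "\<not> c"] by simp
    have S: "S = (#) b ` slice b S" using split b by (cases b) auto
    have "subcube n d (slice b S) \<or> 3 * 2 ^ d \<le> 2 * card (slice b S)"
    proof (rule Suc.IH[OF len])
      show "slice b S \<noteq> {}" using S Suc.prems(2) by auto
      show "d \<le> cube_degree (slice b S) w" if "w \<in> slice b S" for w
        using deg[of b w] that b by (auto simp: slice_def)
    qed
    then show ?thesis
      using subcube.fixed[of n d "slice b S" b] card[of b] b S by auto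
  next
    case False
    then have ne: "slice b S \<noteq> {}" for b by blast
    have pos: "card (slice b S) \<ge> 1" for b
      using ne[of b] finite_subset[OF len finite_length_eq] card_gt_0_iff[of "slice b S"] by auto
    show ?thesis
    proof (cases d)
      case 0
      \<comment> \<open>One vertex in each half already exceeds the bound 3/2.\<close>
      with card[of True] pos[of True] pos[of False] show ?thesis by simp
    next
      case d: (Suc e)
      have degs: "e \<le> cube_degree (slice b S) w" if "w \<in> slice b S" for b w
        using deg[of b w] that d by (cases "(\<not> b) # w \<in> S") auto
      have IH: "subcube n e (slice b S) \<or> 3 * 2 ^ e \<le> 2 * card (slice b S)" for b
        by (rule Suc.IH[OF len ne degs])
      \<comment> \<open>A vertex has only \<open>e\<close> neighbours inside a subcube of dimension
        \<open>e\<close>; the missing one must come from flipping the first bit.\<close>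
      have partner: "slice b S \<subseteq> slice (\<not> b) S" if "subcube n e (slice b S)" for b
      proof
        fix w assume w: "w \<in> slice b S"
        with deg[of b w] cube_degree_subcube[OF that w] d show "w \<in> slice (\<not> b) S"
          by (cases "(\<not> b) # w \<in> S") auto
      qed
      consider (both) "subcube n e (slice True S)" "subcube n e (slice False S)"
        | (one) b where "subcube n e (slice b S)" "\<not> subcube n e (slice (\<not> b) S)"
        | (none) "\<not> subcube n e (slice True S)" "\<not> subcube n e (slice False S)"
        by (metis (full_types))
      then show ?thesis
      proof cases
        case both
        with partner[of True] partner[of False] have "slice False S = slice True S" by auto
        with split subcube.free[OF both(1)] d show ?thesis by simp
      next
        case one
        let ?A = "slice b S" and ?B = "slice (\<not> b) S"
        have sub: "?A \<subseteq> ?B" using partner one(1) .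
        have "e \<le> cube_degree (?B - ?A) w" if w: "w \<in> ?B - ?A" for w
        proof -
          \<comment> \<open>The partner \<open>b # w\<close> is not in \<open>S\<close>, so at least
            \<open>d\<close> neighbours lie in \<open>?B\<close> itself; at most one of them is in
            \<open>?A\<close>.\<close>
          have "d \<le> cube_degree ?B w" using deg[of "\<not> b" w] w by auto
          also have "\<dots> \<le> cube_degree (?B - ?A) w + cube_degree ?A w"
            using cube_degree_Un_le[of "?B - ?A" ?A w] sub by (simp add: Un_absorb2)
          also have "cube_degree ?A w \<le> 1"
            using cube_degree_outside_subcube[OF one(1)] w len by blast
          finally show ?thesis using d by simp
        qed
        moreover have "?B - ?A \<subseteq> {v. length v = n}" using len by blast
        moreover have "?B - ?A \<noteq> {}" using sub one by (metis Diff_eq_empty_iff subset_antisym)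
        ultimately have "subcube n e (?B - ?A) \<or> 3 * 2 ^ e \<le> 2 * card (?B - ?A)"
          by (intro Suc.IH)
        \<comment> \<open>Both alternatives give at least \<open>2 ^ e\<close>. As \<open>?A\<close>
          also occurs inside \<open>?B\<close>, it counts twice, so \<open>S\<close> has at least
          \<open>3 * 2 ^ e\<close> vertices.\<close>
        then have "2 ^ e \<le> card (?B - ?A)" using card_subcube by fastforce
        moreover have "card ?B = card (?B - ?A) + card ?A"
          using sub finite_subset[OF len finite_length_eq]
          by (metis add.commute card_Diff_subset card_mono le_add_diff_inverse)
        ultimately show ?thesis
          using card[of b] card_subcube[OF one(1)] d by simp
      next
        case none
        \<comment> \<open>Adding the two lower bounds gives the bound for
          \<open>d = Suc e\<close>.\<close>
        with IH[of True] IH[of False] card[of True] d show ?thesis by simp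
      qed
    qed
  qed
qed

section \<open>Recursive subcubes agree with sets of strings having prescribed bits\<close>

lemma fixed_positions_insert_0:
  "{v. length v = Suc n \<and> (\<forall>i\<in>insert 0 (Suc ` J). v ! i = a i)} =
    (#) (a 0) ` {v. length v = n \<and> (\<forall>i\<in>J. v ! i = a (Suc i))}" (is "?L = ?R")
proof (rule set_eqI)
  fix v show "v \<in> ?L \<longleftrightarrow> v \<in> ?R" by (cases v) auto
qed

lemma fixed_positions_Suc:
  "{v. length v = Suc n \<and> (\<forall>i\<in>Suc ` J. v ! i = a i)} =
    (#) True ` {v. length v = n \<and> (\<forall>i\<in>J. v ! i = a (Suc i))} \<union>
    (#) False ` {v. length v = n \<and> (\<forall>i\<in>J. v ! i = a (Suc i))}" (is "?L = ?R")
proof (rule set_eqI)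
  fix v show "v \<in> ?L \<longleftrightarrow> v \<in> ?R"
  proof (cases v)
    case (Cons b w)
    then show ?thesis by (cases b) auto
  qed auto
qed

lemma subcube_imp_fixed_positions:
  "subcube n d S \<Longrightarrow>
    \<exists>I a. I \<subseteq> {..<n} \<and> card I + d = n \<and> S = {v. length v = n \<and> (\<forall>i\<in>I. v ! i = a i)}"
proof (induction rule: subcube.induct)
  case point
  show ?case by (intro exI[of _ "{}"]) auto
next
  case (fixed n d S b)
  then obtain I a where I: "I \<subseteq> {..<n}" "card I + d = n"
    and S: "S = {v. length v = n \<and> (\<forall>i\<in>I. v ! i = a i)}" by blast
  have "finite I" using I(1) finite_subset by blast
  then have "card (insert 0 (Suc ` I)) + d = Suc n"
    using I(2) by (simp add: card_image)
  moreover have "insert 0 (Suc ` I) \<subseteq> {..<Suc n}" using I(1) by auto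
  \<comment> \<open>\<open>case_nat b a\<close> puts \<open>b\<close> at position 0 and shifts the
    bits of \<open>a\<close> by one.\<close>
  moreover have "(#) b ` S =
      {v. length v = Suc n \<and> (\<forall>i\<in>insert 0 (Suc ` I). v ! i = case_nat b a i)}"
    unfolding fixed_positions_insert_0 by (simp add: S)
  ultimately show ?case by blast
next
  case (free n d S)
  then obtain I a where I: "I \<subseteq> {..<n}" "card I + d = n"
    and S: "S = {v. length v = n \<and> (\<forall>i\<in>I. v ! i = a i)}" by blast
  have "card (Suc ` I) + Suc d = Suc n" using I(2) by (simp add: card_image)
  moreover have "Suc ` I \<subseteq> {..<Suc n}" using I(1) by auto
  \<comment> \<open>Here \<open>False\<close> is a dummy value, since position 0 is not
    fixed.\<close>
  moreover have "(#) True ` S \<union> (#) False ` S =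
      {v. length v = Suc n \<and> (\<forall>i\<in>Suc ` I. v ! i = case_nat False a i)}"
    unfolding fixed_positions_Suc by (simp add: S)
  ultimately show ?case by blast
qed

lemma fixed_positions_imp_subcube:
  "I \<subseteq> {..<n} \<Longrightarrow> card I + d = n \<Longrightarrow> subcube n d {v. length v = n \<and> (\<forall>i\<in>I. v ! i = a i)}"
proof (induction n arbitrary: I a d)
  case 0
  then have "I = {}" "d = 0" by auto
  then show ?case using subcube.point by (simp add: Collect_conv_if)
next
  case (Suc n)
  \<comment> \<open>The fixed positions other than 0, renumbered for the tail.\<close>
  define J where "J = {i. Suc i \<in> I}"
  let ?T = "{v. length v = n \<and> (\<forall>i\<in>J. v ! i = a (Suc i))}"
  have J: "J \<subseteq> {..<n}" using Suc.prems(1) by (auto simp: J_def)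
  have fin: "finite J" using J finite_subset by blast
  show ?case
  proof (cases "0 \<in> I")
    case True
    have I: "I = insert 0 (Suc ` J)"
    proof (rule set_eqI)
      fix i show "i \<in> I \<longleftrightarrow> i \<in> insert 0 (Suc ` J)" by (cases i) (auto simp: J_def True)
    qed
    have "card J + d = n" using Suc.prems(2) fin by (simp add: I card_image)
    from subcube.fixed[OF Suc.IH[OF J this, of "\<lambda>i. a (Suc i)"], of "a 0"]
    have "subcube (Suc n) d ((#) (a 0) ` ?T)" .
    also have "(#) (a 0) ` ?T = {v. length v = Suc n \<and> (\<forall>i\<in>I. v ! i = a i)}"
      unfolding I fixed_positions_insert_0 ..
    finally show ?thesis .
  next
    case False
    have I: "I = Suc ` J"
    proof (rule set_eqI)
      fix i show "i \<in> I \<longleftrightarrow> i \<in> Suc ` J" by (cases i) (auto simp: J_def False)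
    qed
    have "card J + d = Suc n" using Suc.prems(2) by (simp add: I card_image)
    \<comment> \<open>This forces \<open>d\<close> to be positive, as the rule \<open>free\<close>
      requires.\<close>
    moreover have "card J \<le> n" using card_mono[OF _ J] by simp
    ultimately obtain e where e: "d = Suc e" "card J + e = n" by (cases d) auto
    from subcube.free[OF Suc.IH[OF J e(2), of "\<lambda>i. a (Suc i)"]]
    have "subcube (Suc n) d ((#) True ` ?T \<union> (#) False ` ?T)" unfolding e(1) .
    also have "(#) True ` ?T \<union> (#) False ` ?T = {v. length v = Suc n \<and> (\<forall>i\<in>I. v ! i = a i)}"
      unfolding I fixed_positions_Suc ..
    finally show ?thesis .
  qed
qed

section \<open>Transfer to induced subgraphs of the hypercube\<close>

lemma verts_hypercube [simp]: "verts (hypercube n) = {v. length v = n}"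
  by (simp add: hypercube_def)

lemma flip_iff_differ_in_one:
  assumes "length u = n" "length v = n"
  shows "card {i. i < n \<and> u ! i \<noteq> v ! i} = 1 \<longleftrightarrow> (\<exists>i<n. v = flip i u)"
proof
  assume "card {i. i < n \<and> u ! i \<noteq> v ! i} = 1"
  then obtain i where i: "{i. i < n \<and> u ! i \<noteq> v ! i} = {i}" by (auto simp: card_1_singleton_iff)
  then have "i < n" by auto
  moreover have "v = flip i u"
  proof (rule nth_equalityI)
    show "length v = length (flip i u)" using assms by (simp add: flip_def)
    fix j assume "j < length v"
    then show "v ! j = flip i u ! j"
      using i assms by (cases "j = i") (auto simp: flip_def)
  qed
  ultimately show "\<exists>i<n. v = flip i u" by blast
next
  assume "\<exists>i<n. v = flip i u"
  then obtain i where "i < n" "v = flip i u" by blast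
  then have "{i. i < n \<and> u ! i \<noteq> v ! i} = {i}"
    using assms by (auto simp: flip_def nth_list_update split: if_splits)
  then show "card {i. i < n \<and> u ! i \<noteq> v ! i} = 1" by simp
qed

text \<open>Because \<open>G\<close> is induced, the arcs leaving \<open>u\<close> are exactly the
  flips of \<open>u\<close> that stay in \<open>verts G\<close>, and distinct positions give
  distinct arcs.\<close>

lemma out_degree_induced_hypercube:
  assumes G: "induced_subgraph G (hypercube n)" and u: "u \<in> verts G"
  shows "out_degree G u = cube_degree (verts G) u"
proof -
  have V: "verts G \<subseteq> {v. length v = n}"
    using G by (auto simp: induced_subgraph_def subgraph_def)
  have arcs: "arcs G = {e \<in> arcs (hypercube n). fst e \<in> verts G \<and> snd e \<in> verts G}"
    using G by (simp add: induced_subgraph_def hypercube_def)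
  have tail: "tail G = fst"
    using G by (simp add: induced_subgraph_def subgraph_def compatible_def hypercube_def)
  have len: "length u = n" using u V by blast
  let ?J = "{i. i < length u \<and> flip i u \<in> verts G}"
  have arc_iff: "(u, v) \<in> arcs G \<longleftrightarrow> (\<exists>i<n. v = flip i u) \<and> v \<in> verts G" for v
  proof (cases "v \<in> verts G")
    case True
    then have "length v = n" using V by blast
    with True u show ?thesis
      using flip_iff_differ_in_one[OF len, of v] len by (simp add: arcs hypercube_def)
  qed (simp add: arcs)
  have "out_arcs G u = (\<lambda>i. (u, flip i u)) ` ?J"
  proof (rule set_eqI)
    fix e :: "bool list \<times> bool list"
    obtain x v where e: "e = (x, v)" by (cases e)
    show "e \<in> out_arcs G u \<longleftrightarrow> e \<in> (\<lambda>i. (u, flip i u)) ` ?J"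
      using arc_iff[of v] len by (auto simp: e out_arcs_def tail)
  qed
  moreover have "inj_on (\<lambda>i. (u, flip i u)) ?J"
  proof (rule inj_onI)
    fix i j assume ij: "i \<in> ?J" "j \<in> ?J" "(u, flip i u) = (u, flip j u)"
    \<comment> \<open>Compare at position \<open>i\<close>: only the flip at \<open>i\<close> itself
      changes that bit.\<close>
    then have "flip i u ! i = flip j u ! i" by simp
    moreover have "i < length u" using ij(1) by simp
    ultimately show "i = j"
      by (cases "i = j") (simp_all add: flip_def)
  qed
  ultimately show ?thesis
    by (simp add: out_degree_def cube_degree_def card_image)
qed

theorem theorem3:
  fixes n d :: nat
    and G :: "(bool list, bool list \<times> bool list) pre_digraph"
  assumes "induced_subgraph G (hypercube n)"
    and "verts G \<noteq> {}"
    and "min_degree G = d"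
  shows "(card (verts G) = 2 ^ d \<or> real (card (verts G)) \<ge> 3 / 2 * 2 ^ d) \<and>
         (card (verts G) = 2 ^ d \<longleftrightarrow> is_subcube n d G)"
proof -
  let ?V = "verts G"
  have V: "?V \<subseteq> {v. length v = n}"
    using assms(1) by (auto simp: induced_subgraph_def subgraph_def)
  have fin: "finite ?V" using finite_subset[OF V finite_length_eq] .
  have "d \<le> cube_degree ?V v" if "v \<in> ?V" for v
    using assms(3) fin that out_degree_induced_hypercube[OF assms(1) that, symmetric]
    by (auto simp: min_degree_def)
  from min_degree_subcube_or_large[OF V assms(2) this]
  have dich: "subcube n d ?V \<or> 3 * 2 ^ d \<le> 2 * card ?V" .
  have sub: "is_subcube n d G \<longleftrightarrow> subcube n d ?V"
  proof
    assume "is_subcube n d G"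
    then show "subcube n d ?V"
      unfolding is_subcube_def by (auto intro: fixed_positions_imp_subcube)
  next
    assume "subcube n d ?V"
    from subcube_imp_fixed_positions[OF this] obtain I a where
      I: "I \<subseteq> {..<n}" "card I + d = n" and
      eq: "?V = {v. length v = n \<and> (\<forall>i\<in>I. v ! i = a i)}" by blast
    \<comment> \<open>An induced subgraph is determined by its vertex set, so the description of the
      vertices lifts to an equality of digraphs.\<close>
    have "G = hypercube n \<restriction> ?V"
      using assms(1)
      by (auto simp: induced_subgraph_def induce_subgraph_def subgraph_def compatible_def)
    then show "is_subcube n d G"
      unfolding is_subcube_def using I eq by auto
  qed
  have large: "3 * 2 ^ d \<le> 2 * card ?V \<Longrightarrow> real (card ?V) \<ge> 3 / 2 * 2 ^ d"
  proof -
    assume "3 * 2 ^ d \<le> 2 * card ?V"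
    then have "real (3 * 2 ^ d) \<le> real (2 * card ?V)" by (rule of_nat_mono)
    then show ?thesis by simp
  qed
  \<comment> \<open>The two alternatives exclude each other, so cardinality \<open>2 ^ d\<close>
    leaves only the subcube.\<close>
  have "card ?V \<noteq> 2 ^ d" if "3 * 2 ^ d \<le> 2 * card ?V"
  proof
    assume "card ?V = 2 ^ d"
    with that have "3 * 2 ^ d \<le> 2 * (2 ^ d :: nat)" by simp
    then show False by simp
  qed
  with dich sub large card_subcube[of n d ?V] show ?thesis by blast
qed

end
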